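(* Let $\beta$ be a (positive or negative) constant and $\alpha$ a constant. Given $\theta$, $x$ and $y$, write $v=v(\theta,x)=\arg\min_{v}E(\theta,x,v)$ for the equilibrium configuration of node pressures, and let $u=(u_1,\dots,u_N)$ be the configuration of chemical concentrations at the nodes, which satisfies $$\frac{\partial^2E}{\partial v^2}(\theta,x,v(\theta,x))\cdot u=-\beta\,\frac{\partial C}{\partial v}(v(\theta,x),y).$$ Let each parameter $\theta_{jk}$ be updated according to the learning rule $$\Delta\theta_{jk}=-\alpha\,(u_j-u_k)\cdot(v_j-v_k).$$ Then for every parameter $\theta_{jk}$ it holds that $$\Delta\theta_{jk}=-\alpha\,\beta\,\frac{\partial\mathcal{L}}{\partial\theta_{jk}}(\theta,x,y),$$ where $\mathcal{L}(\theta,x,y)=C(v(\theta,x),y)$.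
   Context: Setting (nonlinear flow network): a network of $N$ nodes interconnected by tubes (branches), some linear and others nonlinear, formally equivalent to a nonlinear resistive network. $v=(v_1,\dots,v_N)$ is the configuration of node pressures. $\theta=\{\theta_{jk}:\text{linear branch }(j,k)\}$ is the vector of conductances of the linear branches; these are the trainable parameters. $x=(x_1,\dots,x_N)$ is the vector of input signals, with $x_j=0$ if node $j$ is not an input node. The energy function of the network is $$E(\theta,x,v)=E_{\rm input}(x,v)+E_{\rm nonlinear}(v)+\sum_{\text{linear branch }(j,k)}\tfrac12\,\theta_{jk}\,(v_j-v_k)^2,$$ where $E_{\rm input}(x,v)$ is a function of $x$ and $v$, and $E_{\rm nonlinear}(v)$ is a function of $v$ only. Here $E_{\rm nonlinear}(v)=\sum_{\text{nonlinear branch }(j,k)}\int_0^{v_j-v_k}\widehat{i}_{jk}(v')\,dv'$, where $\widehat{i}_{jk}$ is the real-valued current-pressure characteristic of branch $(j,k)$. The input term is either $\sum_{j\text{ input node}}x_jv_j$ (boundary currents), or $0$ if $v_j=x_j$ for every input node $j$ and $+\infty$ otherwise (boundary pressures). $C(v,y)$ is a cost function measuring the discrepancy between the configuration $v$ and the desired output $y$, and $\mathcal{L}(\theta,x,y)=C(v(\theta,x),y)$ is the per-example loss function. Physically, chemical currents $-\beta\,\frac{\partial C}{\partial v}(v(\theta,x),y)$ are injected at the output nodes, and it is assumed that the node pressures $v(\theta,x)$ are not affected by the chemical; the resulting equilibrium chemical concentration $u$ then satisfies the linear equation stated in the claim.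
   Formalization: For boundary pressures E is infinite off the clamped values, so derivatives in v are taken at non-input nodes and u=0 at input nodes; v(θ,x) is a chosen minimizer (never unique for boundary currents); differentiability of v in each parameter, of C, and regular characteristics are made explicit. *)

theory Defs
  imports "HOL-Analysis.Analysis"
begin

datatype input_mode = Boundary_Currents | Boundary_Pressures

text \<open>
  The nodes are the elements of the finite type \<^typ>\<open>'n\<close>. A branch between two nodes is recorded
  once, as an ordered pair; the order fixes the sign convention for the pressure drop
  across it.
\<close>

record 'n flow_network =
  linear_branches :: "('n \<times> 'n) set"
  nonlinear_branches :: "('n \<times> 'n) set"
  characteristic :: "'n \<times> 'n \<Rightarrow> real \<Rightarrow> real"
  input_nodes :: "'n set"
  boundary :: input_mode

definition input_energy :: "'n::finite flow_network \<Rightarrow> real^'n \<Rightarrow> real^'n \<Rightarrow> ereal" where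
  "input_energy net x v =
     (case boundary net of
        Boundary_Currents \<Rightarrow> ereal (\<Sum>j\<in>input_nodes net. x $ j * v $ j)
      | Boundary_Pressures \<Rightarrow> (if \<forall>j\<in>input_nodes net. v $ j = x $ j then 0 else \<infinity>))"

definition nonlinear_energy :: "'n::finite flow_network \<Rightarrow> real^'n \<Rightarrow> real" where
  "nonlinear_energy net v =
     (\<Sum>(j, k)\<in>nonlinear_branches net.
        LBINT s=0..ereal (v $ j - v $ k). characteristic net (j, k) s)"

text \<open>
  Conductances are functions on ordered pairs; only the values on \<^const>\<open>linear_branches\<close> matter.
\<close>

definition energy ::
    "'n::finite flow_network \<Rightarrow> ('n \<times> 'n \<Rightarrow> real) \<Rightarrow> real^'n \<Rightarrow> real^'n \<Rightarrow> ereal" where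
  "energy net \<theta> x v =
     input_energy net x v + ereal (nonlinear_energy net v)
     + ereal (\<Sum>(j, k)\<in>linear_branches net. 1/2 * \<theta> (j, k) * (v $ j - v $ k)\<^sup>2)"

text \<open>
  A minimiser need not be unique: with boundary currents, \<^const>\<open>energy\<close> depends on \<open>v\<close> only through
  pressure differences and the term linear in \<open>x\<close>, so minimisers are at best unique up to
  adding a constant to all pressures. Hence a predicate and not a function.
\<close>

definition is_equilibrium ::
    "'n::finite flow_network \<Rightarrow> ('n \<times> 'n \<Rightarrow> real) \<Rightarrow> real^'n \<Rightarrow> real^'n \<Rightarrow> bool" where
  "is_equilibrium net \<theta> x v \<longleftrightarrow> is_arg_min (energy net \<theta> x) (\<lambda>_. True) v"

text \<open>
  The nodes whose pressures are variables of the energy. With boundary pressures, the energy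
  is infinite as soon as the pressure at an input node is varied, so derivatives in \<open>v\<close> make
  sense only in the remaining coordinates.
\<close>

definition free_nodes :: "'n flow_network \<Rightarrow> 'n set" where
  "free_nodes net =
     (case boundary net of
        Boundary_Currents \<Rightarrow> UNIV
      | Boundary_Pressures \<Rightarrow> - input_nodes net)"

definition node_partial :: "'n::finite \<Rightarrow> (real^'n \<Rightarrow> real) \<Rightarrow> real^'n \<Rightarrow> real" where
  "node_partial m f v = deriv (\<lambda>s. f (v + s *\<^sub>R axis m 1)) 0"

text \<open>
  The entries in rows and columns of \<^const>\<open>free_nodes\<close> are the meaningful ones: there, the energy is
  differentiated along directions in which it stays finite (if it is finite at \<open>v\<close>).
\<close>

definition energy_hessian ::
    "'n::finite flow_network \<Rightarrow> ('n \<times> 'n \<Rightarrow> real) \<Rightarrow> real^'n \<Rightarrow> real^'n \<Rightarrow> real^'n^'n" where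
  "energy_hessian net \<theta> x v =
     (\<chi> m l. node_partial l (node_partial m (\<lambda>w. real_of_ereal (energy net \<theta> x w))) v)"

text \<open>
  The linear equation for the chemical concentrations \<open>u\<close>, where \<open>c\<close> is the cost as a function of
  the pressures. With boundary currents all nodes are free, and this is the full \<open>N \<times> N\<close>
  system. With boundary pressures it is the system on the free nodes, and the concentrations
  at the clamped nodes are zero, so that \<open>u\<close> is a direction in which the energy is finite.
\<close>

definition is_chemical_equilibrium ::
    "'n::finite flow_network \<Rightarrow> ('n \<times> 'n \<Rightarrow> real) \<Rightarrow> real^'n \<Rightarrow> real^'n
      \<Rightarrow> real \<Rightarrow> (real^'n \<Rightarrow> real) \<Rightarrow> real^'n \<Rightarrow> bool" where
  "is_chemical_equilibrium net \<theta> x v \<beta> c u \<longleftrightarrow>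
     (\<forall>m\<in>free_nodes net.
        (\<Sum>l\<in>free_nodes net. energy_hessian net \<theta> x v $ m $ l * u $ l) = - \<beta> * node_partial m c v)
     \<and> (\<forall>j. j \<notin> free_nodes net \<longrightarrow> u $ j = 0)"

definition loss ::
    "(('n \<times> 'n \<Rightarrow> real) \<Rightarrow> real^'n::finite \<Rightarrow> real^'n) \<Rightarrow> (real^'n \<Rightarrow> 'y \<Rightarrow> real)
      \<Rightarrow> ('n \<times> 'n \<Rightarrow> real) \<Rightarrow> real^'n \<Rightarrow> 'y \<Rightarrow> real" where
  "loss v C \<theta> x y = C (v \<theta> x) y"

end

theory Submission
  imports Defs
begin

text \<open>
  Let \<open>E\<^sub>v(\<theta>, w) h\<close> be the derivative of the energy in direction \<open>h\<close>, and \<open>H\<close> the Hessian form at the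
  equilibrium. Equilibria are stationary, so \<open>E\<^sub>v(\<theta>, v(\<theta>)) h = 0\<close> for every admissible \<open>h\<close>;
  differentiating in \<open>\<theta>\<^sub>j\<^sub>k\<close> gives \<open>H(v', h) + (v\<^sub>j - v\<^sub>k) (h\<^sub>j - h\<^sub>k) = 0\<close>, where \<open>v'\<close> is the sensitivity
  of the equilibrium. For \<open>h = u\<close>, symmetry of \<open>H\<close> and the equation for \<open>u\<close> turn \<open>H(v', u)\<close> into
  \<open>- \<beta> C\<^sub>v v'\<close>, which is \<open>- \<beta>\<close> times the derivative of the loss. With boundary pressures, \<open>v'\<close> and \<open>u\<close>
  both vanish at the clamped nodes, so both are admissible directions.
\<close>

section \<open>Real-valued energy and its first and second variations\<close>

definition pressure_drop :: "'n \<times> 'n \<Rightarrow> real^'n::finite \<Rightarrow> real" where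
  "pressure_drop b w = w $ fst b - w $ snd b"

definition input_power :: "'n::finite flow_network \<Rightarrow> real^'n \<Rightarrow> real^'n \<Rightarrow> real" where
  "input_power net x w =
     (case boundary net of
        Boundary_Currents \<Rightarrow> (\<Sum>j\<in>input_nodes net. x $ j * w $ j)
      | Boundary_Pressures \<Rightarrow> 0)"

text \<open>This drops the infinite penalty for violated boundary pressures, so it is real on all
  configurations and can be differentiated along any line.\<close>

definition finite_energy ::
    "'n::finite flow_network \<Rightarrow> ('n \<times> 'n \<Rightarrow> real) \<Rightarrow> real^'n \<Rightarrow> real^'n \<Rightarrow> real" where
  "finite_energy net \<theta> x w =
     input_power net x w
     + (\<Sum>b\<in>nonlinear_branches net. LBINT s=0..ereal (pressure_drop b w). characteristic net b s)
     + (\<Sum>b\<in>linear_branches net. 1/2 * \<theta> b * (pressure_drop b w)\<^sup>2)"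

definition energy_gradient ::
    "'n::finite flow_network \<Rightarrow> ('n \<times> 'n \<Rightarrow> real) \<Rightarrow> real^'n \<Rightarrow> real^'n \<Rightarrow> real^'n \<Rightarrow> real" where
  "energy_gradient net \<theta> x w h =
     input_power net x h
     + (\<Sum>b\<in>nonlinear_branches net. characteristic net b (pressure_drop b w) * pressure_drop b h)
     + (\<Sum>b\<in>linear_branches net. \<theta> b * pressure_drop b w * pressure_drop b h)"

text \<open>A form in two directions, rather than a matrix, makes the symmetry visible and accepts
  directions such as the sensitivity of the equilibrium. The input term is linear in the pressures
  and leaves no trace, hence no \<open>x\<close>.\<close>

definition hessian_form ::
    "'n::finite flow_network \<Rightarrow> ('n \<times> 'n \<Rightarrow> real) \<Rightarrow> real^'n \<Rightarrow> real^'n \<Rightarrow> real^'n \<Rightarrow> real" where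
  "hessian_form net \<theta> w g h =
     (\<Sum>b\<in>nonlinear_branches net.
        deriv (characteristic net b) (pressure_drop b w) * pressure_drop b g * pressure_drop b h)
     + (\<Sum>b\<in>linear_branches net. \<theta> b * pressure_drop b g * pressure_drop b h)"

definition feasible :: "'n flow_network \<Rightarrow> real^'n \<Rightarrow> real^'n::finite \<Rightarrow> bool" where
  "feasible net x w \<longleftrightarrow> (\<forall>j. j \<notin> free_nodes net \<longrightarrow> w $ j = x $ j)"

lemma linear_pressure_drop: "linear (pressure_drop b)"
  by (rule linearI) (auto simp: pressure_drop_def algebra_simps)

lemma pressure_drop_add: "pressure_drop b (v + w) = pressure_drop b v + pressure_drop b w"
  and pressure_drop_scale: "pressure_drop b (s *\<^sub>R w) = s * pressure_drop b w"
  by (simp_all add: linear_add[OF linear_pressure_drop] linear_cmul[OF linear_pressure_drop])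

lemma input_power_add: "input_power net x (v + w) = input_power net x v + input_power net x w"
  by (simp add: input_power_def algebra_simps sum.distrib split: input_mode.split)

lemma input_power_scale: "input_power net x (s *\<^sub>R w) = s * input_power net x w"
  by (simp add: input_power_def sum_distrib_left algebra_simps split: input_mode.split)

lemma linear_hessian_form: "linear (hessian_form net \<theta> w g)"
  by (rule linearI)
    (auto simp: hessian_form_def pressure_drop_add pressure_drop_scale algebra_simps
      sum.distrib sum_distrib_left)

lemma hessian_form_commute: "hessian_form net \<theta> w g h = hessian_form net \<theta> w h g"
  by (simp add: hessian_form_def mult_ac)

section \<open>Feasible configurations: where the energy is finite\<close>

lemma energy_eq:
  "energy net \<theta> x w = (if feasible net x w then ereal (finite_energy net \<theta> x w) else \<infinity>)"
  by (cases "boundary net")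
    (auto simp: energy_def input_energy_def nonlinear_energy_def finite_energy_def feasible_def
      free_nodes_def input_power_def pressure_drop_def case_prod_unfold)

lemma feasible_add_scale:
  assumes "feasible net x w" and "\<And>j. j \<notin> free_nodes net \<Longrightarrow> h $ j = 0"
  shows "feasible net x (w + s *\<^sub>R h)"
  using assms by (auto simp: feasible_def)

lemma equilibrium_feasible:
  assumes "is_equilibrium net \<theta> x w"
  shows "feasible net x w"
proof (rule ccontr)
  assume "\<not> feasible net x w"
  \<comment> \<open>Read as a configuration of pressures, \<open>x\<close> itself meets every
    clamping constraint, so some configuration has finite energy.\<close>
  moreover have "feasible net x x" by (simp add: feasible_def)
  ultimately have "energy net \<theta> x x < energy net \<theta> x w" by (simp add: energy_eq)
  then show False using assms by (auto simp: is_equilibrium_def is_arg_min_def)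
qed

section \<open>First derivative of the energy and stationarity\<close>

lemma interval_integral_has_real_derivative:
  fixes f :: "real \<Rightarrow> real"
  assumes "continuous_on UNIV f"
  shows "((\<lambda>r. LBINT s=0..ereal r. f s) has_real_derivative f r) (at r)"
proof -
  \<comment> \<open>The interval must contain the base point 0 and have \<open>r\<close> in its
    interior, so that the derivative within it is a two-sided one.\<close>
  let ?a = "min 0 r - 1" and ?b = "max 0 r + 1"
  have "((\<lambda>r. LBINT s=ereal 0..ereal r. f s) has_vector_derivative f r) (at r within {?a..?b})"
    by (rule interval_integral_FTC2) (auto intro: continuous_on_subset[OF assms])
  moreover have "at r within {?a..?b} = at r"
    by (rule at_within_interior) (auto simp: interior_atLeastAtMost_real)
  ultimately show ?thesis
    by (simp add: has_real_derivative_iff_has_vector_derivative zero_ereal_def)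
qed

lemma finite_energy_directional_derivative:
  assumes "\<And>b. b \<in> nonlinear_branches net \<Longrightarrow> continuous_on UNIV (characteristic net b)"
  shows "((\<lambda>s. finite_energy net \<theta> x (w + s *\<^sub>R h)) has_real_derivative
           energy_gradient net \<theta> x w h) (at 0)"
proof -
  have nonlinear: "((\<lambda>s. LBINT r=0..ereal (pressure_drop b w + s * pressure_drop b h).
            characteristic net b r) has_real_derivative
          characteristic net b (pressure_drop b w) * pressure_drop b h) (at 0)"
    if "b \<in> nonlinear_branches net" for b
  proof (rule DERIV_chain2[where f = "\<lambda>r. LBINT s=0..ereal r. characteristic net b s"])
    show "((\<lambda>r. LBINT s=0..ereal r. characteristic net b s) has_real_derivative
        characteristic net b (pressure_drop b w)) (at (pressure_drop b w + 0 * pressure_drop b h))"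
      using interval_integral_has_real_derivative[OF assms[OF that]] by simp
  qed (auto intro!: derivative_eq_intros)
  show ?thesis
    unfolding finite_energy_def energy_gradient_def pressure_drop_add pressure_drop_scale
      input_power_add input_power_scale
    by (intro DERIV_add DERIV_sum nonlinear) (auto intro!: derivative_eq_intros)
qed

text \<open>Since \<open>h\<close> vanishes at the clamped nodes, the whole line stays feasible and
  \<open>real_of_ereal\<close> is never applied to an infinite value.\<close>

lemma energy_directional_derivative:
  assumes "\<And>b. b \<in> nonlinear_branches net \<Longrightarrow> continuous_on UNIV (characteristic net b)"
    and "feasible net x w" and "\<And>j. j \<notin> free_nodes net \<Longrightarrow> h $ j = 0"
  shows "((\<lambda>s. real_of_ereal (energy net \<theta> x (w + s *\<^sub>R h))) has_real_derivative
           energy_gradient net \<theta> x w h) (at 0)"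
  using finite_energy_directional_derivative[OF assms(1)] feasible_add_scale[OF assms(2,3)]
  by (simp add: energy_eq)

lemma equilibrium_stationary:
  assumes "\<And>b. b \<in> nonlinear_branches net \<Longrightarrow> continuous_on UNIV (characteristic net b)"
    and "is_equilibrium net \<theta> x w" and "\<And>j. j \<notin> free_nodes net \<Longrightarrow> h $ j = 0"
  shows "energy_gradient net \<theta> x w h = 0"
\<comment> \<open>The radius 1 is arbitrary: an equilibrium is a global minimiser, so the comparison
  holds for every \<open>s\<close>.\<close>
proof (rule DERIV_local_min[where d = 1])
  show "((\<lambda>s. finite_energy net \<theta> x (w + s *\<^sub>R h)) has_real_derivative
           energy_gradient net \<theta> x w h) (at 0)"
    by (rule finite_energy_directional_derivative[OF assms(1)])
  have feasible: "feasible net x (w + s *\<^sub>R h)" for s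
    by (rule feasible_add_scale[OF equilibrium_feasible[OF assms(2)] assms(3)])
  have "\<not> energy net \<theta> x (w + s *\<^sub>R h) < energy net \<theta> x (w + 0 *\<^sub>R h)" for s
    using assms(2) by (auto simp: is_equilibrium_def is_arg_min_def)
  then show "\<forall>s. \<bar>0 - s\<bar> < 1 \<longrightarrow>
      finite_energy net \<theta> x (w + 0 *\<^sub>R h) \<le> finite_energy net \<theta> x (w + s *\<^sub>R h)"
    using feasible feasible[of 0] by (simp add: energy_eq not_less)
qed simp

section \<open>Second derivatives and the Hessian\<close>

text \<open>Pressures and conductances move together so that one computation serves twice: a
  straight line at fixed conductances yields the Hessian entries, and the curve of equilibria under
  a varying conductance yields the differentiated stationarity condition.\<close>

lemma energy_gradient_curve_derivative:
  assumes "\<And>b. b \<in> nonlinear_branches net \<Longrightarrow>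
        characteristic net b differentiable (at (pressure_drop b (p t)))"
    and p: "(p has_vector_derivative p') (at t)"
    and "\<And>b. b \<in> linear_branches net \<Longrightarrow> ((\<lambda>s. T s b) has_real_derivative T' b) (at t)"
  shows "((\<lambda>s. energy_gradient net (T s) x (p s) h) has_real_derivative
           hessian_form net (T t) (p t) p' h
           + (\<Sum>b\<in>linear_branches net. T' b * pressure_drop b (p t) * pressure_drop b h)) (at t)"
proof -
  have drop: "((\<lambda>s. pressure_drop b (p s)) has_real_derivative pressure_drop b p') (at t)" for b
    unfolding has_real_derivative_iff_has_vector_derivative
    by (rule bounded_linear.has_vector_derivative
        [OF linear_pressure_drop[THEN linear_conv_bounded_linear[THEN iffD1]] p])
  have nonlinear: "((\<lambda>s. characteristic net b (pressure_drop b (p s)) * pressure_drop b h)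
      has_real_derivative deriv (characteristic net b) (pressure_drop b (p t))
        * pressure_drop b p' * pressure_drop b h) (at t)"
    if "b \<in> nonlinear_branches net" for b
    using assms(1)[OF that] drop
    by (intro DERIV_cmult_right DERIV_chain2[where f = "characteristic net b"])
      (auto simp: DERIV_deriv_iff_real_differentiable)
  have linear: "((\<lambda>s. T s b * pressure_drop b (p s) * pressure_drop b h) has_real_derivative
      T t b * pressure_drop b p' * pressure_drop b h
      + T' b * pressure_drop b (p t) * pressure_drop b h) (at t)"
    if "b \<in> linear_branches net" for b
    using assms(3)[OF that] drop[of b]
    by (auto intro!: derivative_eq_intros simp: algebra_simps)
  \<comment> \<open>This is the shape produced by the termwise derivative rules; the leading 0 comes
    from \<open>input_power net x h\<close>, which is constant along the curve.\<close>
  have derivative: "hessian_form net (T t) (p t) p' h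
        + (\<Sum>b\<in>linear_branches net. T' b * pressure_drop b (p t) * pressure_drop b h)
      = 0
        + (\<Sum>b\<in>nonlinear_branches net. deriv (characteristic net b) (pressure_drop b (p t))
            * pressure_drop b p' * pressure_drop b h)
        + (\<Sum>b\<in>linear_branches net. T t b * pressure_drop b p' * pressure_drop b h
            + T' b * pressure_drop b (p t) * pressure_drop b h)"
    by (simp add: hessian_form_def sum.distrib)
  show ?thesis
    unfolding energy_gradient_def derivative
    by (intro DERIV_add DERIV_sum DERIV_const nonlinear linear)
qed

lemma line_has_vector_derivative:
  fixes w h :: "'a::real_normed_vector"
  shows "((\<lambda>s. w + s *\<^sub>R h) has_vector_derivative h) (at t)"
proof -
  have "((\<lambda>s. w + s *\<^sub>R h) has_vector_derivative 0 + (t *\<^sub>R 0 + 1 *\<^sub>R h)) (at t)"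
    by (intro has_vector_derivative_add has_vector_derivative_const has_vector_derivative_scaleR
        DERIV_ident)
  then show ?thesis by simp
qed

lemma energy_hessian_eq:
  assumes "\<And>b. b \<in> nonlinear_branches net \<Longrightarrow> continuous_on UNIV (characteristic net b)"
    and "\<And>b. b \<in> nonlinear_branches net \<Longrightarrow>
        characteristic net b differentiable (at (pressure_drop b w))"
    and "feasible net x w" and "m \<in> free_nodes net" and "l \<in> free_nodes net"
  shows "energy_hessian net \<theta> x w $ m $ l = hessian_form net \<theta> w (axis l 1) (axis m 1)"
proof -
  have axis: "axis i (1::real) $ j = 0" if "i \<in> free_nodes net" "j \<notin> free_nodes net" for i j
    using that by (auto simp: axis_def)
  \<comment> \<open>The inner partial derivative is identified at every \<open>s\<close>, not only
    at 0, because it is differentiated again in \<open>s\<close>.\<close>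
  have "node_partial m (\<lambda>w. real_of_ereal (energy net \<theta> x w)) (w + s *\<^sub>R axis l 1)
      = energy_gradient net \<theta> x (w + s *\<^sub>R axis l 1) (axis m 1)" for s
    unfolding node_partial_def
    by (intro DERIV_imp_deriv energy_directional_derivative assms(1) feasible_add_scale assms(3)
        axis assms(4,5))
  moreover have "((\<lambda>s. energy_gradient net \<theta> x (w + s *\<^sub>R axis l 1) (axis m 1))
      has_real_derivative hessian_form net \<theta> w (axis l 1) (axis m 1)) (at 0)"
    using energy_gradient_curve_derivative[of net "\<lambda>s. w + s *\<^sub>R axis l 1" 0 "axis l 1"
        "\<lambda>_. \<theta>" "\<lambda>_. 0" x "axis m 1"] assms(2)
    by (simp add: line_has_vector_derivative)
  ultimately show ?thesis
    by (simp add: energy_hessian_def node_partial_def[of l] DERIV_imp_deriv)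
qed

section \<open>From the coordinate equations to arbitrary admissible directions\<close>

lemma linear_eq_sum_free:
  fixes L :: "real^'n::finite \<Rightarrow> real"
  assumes "linear L" and "\<And>j. j \<notin> S \<Longrightarrow> h $ j = 0"
  shows "L h = (\<Sum>m\<in>S. h $ m * L (axis m 1))"
proof -
  have "L h = L (\<Sum>m\<in>UNIV. h $ m *\<^sub>R axis m 1)"
    by (simp add: basis_expansion flip: scalar_mult_eq_scaleR)
  also have "\<dots> = (\<Sum>m\<in>UNIV. h $ m * L (axis m 1))"
    by (simp add: linear_sum[OF assms(1)] linear_cmul[OF assms(1)])
  also have "\<dots> = (\<Sum>m\<in>S. h $ m * L (axis m 1))"
    by (rule sum.mono_neutral_right) (auto simp: assms(2))
  finally show ?thesis .
qed

lemma node_partial_eq: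
  assumes "(f has_derivative D) (at w)"
  shows "node_partial m f w = D (axis m 1)"
proof -
  from vector_derivative_diff_chain_within[OF line_has_vector_derivative, of f D w 0 "axis m 1"]
    assms
  have "((\<lambda>s. f (w + s *\<^sub>R axis m 1)) has_real_derivative D (axis m 1)) (at 0)"
    by (simp add: has_real_derivative_iff_has_vector_derivative o_def has_derivative_at_withinI)
  then show ?thesis unfolding node_partial_def by (rule DERIV_imp_deriv)
qed

text \<open>The equation for \<open>u\<close> speaks of the axes of free nodes only. Both sides are
  linear in the test direction, so it extends to every \<open>h\<close> supported on the free
  nodes.\<close>

lemma chemical_equilibrium_hessian_form:
  assumes "\<And>b. b \<in> nonlinear_branches net \<Longrightarrow> continuous_on UNIV (characteristic net b)"
    and "\<And>b. b \<in> nonlinear_branches net \<Longrightarrow>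
        characteristic net b differentiable (at (pressure_drop b w))"
    and "feasible net x w" and D: "(c has_derivative D) (at w)"
    and u: "is_chemical_equilibrium net \<theta> x w \<beta> c u"
    and h: "\<And>j. j \<notin> free_nodes net \<Longrightarrow> h $ j = 0"
  shows "hessian_form net \<theta> w h u = - \<beta> * D h"
proof -
  let ?F = "free_nodes net"
  have axis: "hessian_form net \<theta> w u (axis m 1) = - \<beta> * D (axis m 1)" if "m \<in> ?F" for m
  proof -
    \<comment> \<open>The sum may be restricted to free nodes because \<open>u\<close> is zero at
      the clamped ones.\<close>
    have "hessian_form net \<theta> w (axis m 1) u
        = (\<Sum>l\<in>?F. u $ l * hessian_form net \<theta> w (axis m 1) (axis l 1))"
      using u by (intro linear_eq_sum_free linear_hessian_form)
        (simp add: is_chemical_equilibrium_def)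
    also have "\<dots> = (\<Sum>l\<in>?F. energy_hessian net \<theta> x w $ m $ l * u $ l)"
      using energy_hessian_eq[OF assms(1-3) that]
      by (intro sum.cong) (simp_all add: hessian_form_commute mult.commute)
    also have "\<dots> = - \<beta> * D (axis m 1)"
      using u that node_partial_eq[OF D] by (simp add: is_chemical_equilibrium_def)
    finally show ?thesis by (simp add: hessian_form_commute)
  qed
  have "hessian_form net \<theta> w u h = (\<Sum>m\<in>?F. h $ m * hessian_form net \<theta> w u (axis m 1))"
    using h by (rule linear_eq_sum_free[OF linear_hessian_form])
  also have "\<dots> = - \<beta> * (\<Sum>m\<in>?F. h $ m * D (axis m 1))"
    by (simp add: axis sum_distrib_left mult_ac)
  also have "(\<Sum>m\<in>?F. h $ m * D (axis m 1)) = D h"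
    using linear_eq_sum_free[OF has_derivative_linear[OF D], of ?F h] h by simp
  finally show ?thesis by (simp add: hessian_form_commute)
qed

text \<open>Applied both to clamped pressures and to the energy gradient along the
  equilibria.\<close>

lemma eventually_const_imp_DERIV_zero:
  assumes "(f has_field_derivative D) (at a)" and "\<forall>\<^sub>F t in nhds a. f t = c"
  shows "D = 0"
proof -
  have "((\<lambda>t. c) has_field_derivative D) (at a)"
    using assms(1) DERIV_cong_ev[OF refl assms(2) refl] by simp
  then show ?thesis by (rule DERIV_unique[OF _ DERIV_const])
qed

text \<open>Equilibria may be non-unique, so \<open>v\<close> is a selection of them, assumed
  differentiable along each single trainable conductance. Differentiability of the loss is part of
  the conclusion, which gives \<open>deriv\<close> its intended meaning.\<close>

theorem theorem4:
  fixes net :: "'n::finite flow_network"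
    and v :: "('n \<times> 'n \<Rightarrow> real) \<Rightarrow> real^'n \<Rightarrow> real^'n"
    and C :: "real^'n \<Rightarrow> 'y \<Rightarrow> real"
    and \<theta> \<Delta>\<theta> :: "'n \<times> 'n \<Rightarrow> real"
    and x u :: "real^'n"
    and y :: 'y
    and \<alpha> \<beta> :: real
  assumes "\<beta> \<noteq> 0"
    and "\<And>j. j \<notin> input_nodes net \<Longrightarrow> x $ j = 0"
    and "is_equilibrium net \<theta> x (v \<theta> x)"
    and "\<And>j k. (j, k) \<in> linear_branches net \<Longrightarrow>
           \<forall>\<^sub>F t in nhds (\<theta> (j, k)). is_equilibrium net (\<theta>((j, k) := t)) x (v (\<theta>((j, k) := t)) x)"
    and "\<And>j k. (j, k) \<in> linear_branches net \<Longrightarrow>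
           (\<lambda>t. v (\<theta>((j, k) := t)) x) differentiable (at (\<theta> (j, k)))"
    and "\<And>j k. (j, k) \<in> nonlinear_branches net \<Longrightarrow> continuous_on UNIV (characteristic net (j, k))"
    and "\<And>j k. (j, k) \<in> nonlinear_branches net \<Longrightarrow>
           characteristic net (j, k) differentiable (at (v \<theta> x $ j - v \<theta> x $ k))"
    and "(\<lambda>w. C w y) differentiable (at (v \<theta> x))"
    and "is_chemical_equilibrium net \<theta> x (v \<theta> x) \<beta> (\<lambda>w. C w y) u"
    and "\<And>j k. (j, k) \<in> linear_branches net \<Longrightarrow>
           \<Delta>\<theta> (j, k) = - \<alpha> * (u $ j - u $ k) * (v \<theta> x $ j - v \<theta> x $ k)"
  shows "\<forall>(j, k)\<in>linear_branches net.
           (\<lambda>t. loss v C (\<theta>((j, k) := t)) x y) differentiable (at (\<theta> (j, k))) \<and>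
           \<Delta>\<theta> (j, k) = - \<alpha> * \<beta> * deriv (\<lambda>t. loss v C (\<theta>((j, k) := t)) x y) (\<theta> (j, k))"
proof (rule ballI, rule case_prodI2)
  fix b j k
  assume b: "b \<in> linear_branches net" and bjk: "b = (j, k)"
  have continuous: "continuous_on UNIV (characteristic net b)"
    if "b \<in> nonlinear_branches net" for b
    using assms(6) that by (cases b) auto
  have smooth: "characteristic net b differentiable (at (pressure_drop b (v \<theta> x)))"
    if "b \<in> nonlinear_branches net" for b
    using assms(7) that by (cases b) (auto simp: pressure_drop_def)
  let ?T = "\<lambda>t. \<theta>(b := t)"
  let ?p = "\<lambda>t. v (?T t) x"
  obtain p' where p: "(?p has_vector_derivative p') (at (\<theta> b))"
    using assms(5) b unfolding bjk by (auto simp: vector_derivative_works)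
  obtain D where D: "((\<lambda>w. C w y) has_derivative D) (at (v \<theta> x))"
    using assms(8) by (auto simp: differentiable_def)
  have equilibrium: "\<forall>\<^sub>F t in nhds (\<theta> b). is_equilibrium net (?T t) x (?p t)"
    using assms(4) b unfolding bjk by simp
  have u0: "u $ i = 0" if "i \<notin> free_nodes net" for i
    using assms(9) that by (simp add: is_chemical_equilibrium_def)
  \<comment> \<open>Nearby equilibria all have the prescribed pressure at a clamped node, so the
    sensitivity vanishes there and is an admissible test direction.\<close>
  have p'0: "p' $ i = 0" if "i \<notin> free_nodes net" for i
  proof -
    have "((\<lambda>t. ?p t $ i) has_real_derivative p' $ i) (at (\<theta> b))"
      using bounded_linear.has_vector_derivative[OF bounded_linear_vec_nth p]
      by (simp add: has_real_derivative_iff_has_vector_derivative)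
    moreover have "\<forall>\<^sub>F t in nhds (\<theta> b). ?p t $ i = x $ i"
      using equilibrium by eventually_elim (use that equilibrium_feasible feasible_def in blast)
    ultimately show ?thesis by (rule eventually_const_imp_DERIV_zero)
  qed
  \<comment> \<open>The direction \<open>u\<close> is held fixed while the conductance of
    \<open>b\<close> varies; the indicator is the derivative of \<open>(\<theta>(b := t)) a\<close>
    in \<open>t\<close>.\<close>
  have "((\<lambda>t. energy_gradient net (?T t) x (?p t) u) has_real_derivative
      hessian_form net (?T (\<theta> b)) (?p (\<theta> b)) p' u
      + (\<Sum>a\<in>linear_branches net. (if a = b then 1 else 0)
          * pressure_drop a (?p (\<theta> b)) * pressure_drop a u)) (at (\<theta> b))"
    using smooth by (intro energy_gradient_curve_derivative p) auto
  moreover have "(\<Sum>a\<in>linear_branches net. (if a = b then 1 else 0)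
      * pressure_drop a (v \<theta> x) * pressure_drop a u) = pressure_drop b (v \<theta> x) * pressure_drop b u"
    using b by (subst sum.remove[of _ b]) (auto intro!: sum.neutral)
  ultimately have "((\<lambda>t. energy_gradient net (?T t) x (?p t) u) has_real_derivative
      hessian_form net \<theta> (v \<theta> x) p' u + pressure_drop b (v \<theta> x) * pressure_drop b u) (at (\<theta> b))"
    by simp
  moreover have "\<forall>\<^sub>F t in nhds (\<theta> b). energy_gradient net (?T t) x (?p t) u = 0"
    using equilibrium by eventually_elim (rule equilibrium_stationary[OF continuous _ u0])
  ultimately have "hessian_form net \<theta> (v \<theta> x) p' u + pressure_drop b (v \<theta> x) * pressure_drop b u = 0"
    by (rule eventually_const_imp_DERIV_zero)
  \<comment> \<open>The chemical equation is tested against the sensitivity \<open>p'\<close>, which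
    evaluates the same Hessian term a second time.\<close>
  moreover have "hessian_form net \<theta> (v \<theta> x) p' u = - \<beta> * D p'"
    by (rule chemical_equilibrium_hessian_form[OF continuous smooth
          equilibrium_feasible[OF assms(3)] D assms(9) p'0])
  ultimately have drops: "pressure_drop b (v \<theta> x) * pressure_drop b u = \<beta> * D p'" by simp
  \<comment> \<open>By the chain rule, the number \<open>D p'\<close> just obtained is the
    derivative of the loss.\<close>
  have L: "((\<lambda>t. loss v C (?T t) x y) has_real_derivative D p') (at (\<theta> b))"
    using vector_derivative_diff_chain_within[OF p, of "\<lambda>w. C w y" D] D
    by (simp add: loss_def has_real_derivative_iff_has_vector_derivative o_def
        has_derivative_at_withinI)
  have "\<Delta>\<theta> b = - \<alpha> * (pressure_drop b (v \<theta> x) * pressure_drop b u)"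
    using assms(10)[of j k] b by (simp add: bjk pressure_drop_def)
  also have "\<dots> = - \<alpha> * \<beta> * deriv (\<lambda>t. loss v C (?T t) x y) (\<theta> b)"
    by (simp add: drops DERIV_imp_deriv[OF L])
  finally show "(\<lambda>t. loss v C (\<theta>((j, k) := t)) x y) differentiable (at (\<theta> (j, k))) \<and>
      \<Delta>\<theta> (j, k) = - \<alpha> * \<beta> * deriv (\<lambda>t. loss v C (\<theta>((j, k) := t)) x y) (\<theta> (j, k))"
    using L real_differentiable_def unfolding bjk by blast
qed

end
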